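(* Consider the matching pennies game, i.e. $m_X=m_Y=2$ and $$U=\begin{pmatrix}+1&-1\\-1&+1\end{pmatrix},$$ whose only Nash equilibrium is $x^*=y^*=(1/2,1/2)$. Under the replicator dynamics with memory asymmetry for this game, Y's strategy $y$ converges to the equilibrium strategy $y^*=(1/2,1/2)$ as $t\to\infty$, independent of both players' initial strategies $X(0)$ and $y(0)$.
   Context: Player X has actions $1,\dots,m_X$, player Y has actions $1,\dots,m_Y$; when X plays $i$ and Y plays $j$, X receives $u_{ij}$ (the $(i,j)$ entry of $U$) and Y receives $-u_{ij}$. A reactive strategy of X is an $m_X\times m_Y$ matrix $X=(x_{i|j})$ with nonnegative entries satisfying $\sum_i x_{i|j}=1$ for every $j$ ($x_{i|j}$ is the probability that X plays $i$ when Y's previous action was $j$). Y uses a mixed strategy $y=(y_j)_j$, a probability vector in $\mathbb{R}^{m_Y}$. X's stationary strategy is $x_i^{\mathrm{st}}=\sum_j x_{i|j}y_j$, and X's expected payoff is $$u^{\mathrm{st}}(X,y)=\sum_{i,j}u_{ij}x_i^{\mathrm{st}}y_j=\sum_{i,j,j'}u_{ij'}x_{i|j}y_jy_{j'}.$$ The replicator dynamics with memory asymmetry is the ODE system $$\dot x_{i|j}=x_{i|j}\Big(g_{i|j}-\sum_{i'}x_{i'|j}g_{i'|j}\Big),\qquad \dot y_j=-y_j\Big(h_j-\sum_{j'}y_{j'}h_{j'}\Big),$$ where $g_{i|j}$ and $h_j$ are the partial derivatives of the polynomial $u^{\mathrm{st}}(X,y)$ with respect to $x_{i|j}$ and $y_j$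 (all coordinates treated as independent), i.e. $$g_{i|j}=y_j\sum_{j'}u_{ij'}y_{j'},\qquad h_j=\sum_i u_{ij}x_i^{\mathrm{st}}+\sum_i x_{i|j}\sum_{j'}u_{ij'}y_{j'}.$$
   Formalization: Initial strategies X(0) and y(0) are assumed fully mixed (all entries strictly positive); otherwise the claim fails, e.g. y(0)=(1,0) is stationary, and x_{1|1}(0)=x_{1|2}(0)=1 drives y to (0,1). *)

theory Defs
  imports "HOL-Analysis.Analysis"
begin

definition mixed_strategy :: "real^'n \<Rightarrow> bool" where
  "mixed_strategy p \<longleftrightarrow> (\<forall>i. 0 \<le> p $ i) \<and> (\<Sum>i\<in>UNIV. p $ i) = 1"

text \<open>The payoff is that of the row player; the column player receives its negative.\<close>

definition payoff :: "real^'n^'m \<Rightarrow> real^'m \<Rightarrow> real^'n \<Rightarrow> real" where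
  "payoff U x y = (\<Sum>i\<in>UNIV. \<Sum>j\<in>UNIV. U $ i $ j * x $ i * y $ j)"

definition nash_equilibrium :: "real^'n^'m \<Rightarrow> real^'m \<Rightarrow> real^'n \<Rightarrow> bool" where
  "nash_equilibrium U x y \<longleftrightarrow> mixed_strategy x \<and> mixed_strategy y \<and>
     (\<forall>x'. mixed_strategy x' \<longrightarrow> payoff U x' y \<le> payoff U x y) \<and>
     (\<forall>y'. mixed_strategy y' \<longrightarrow> - payoff U x y' \<le> - payoff U x y)"

text \<open>The entry \<open>X $ i $ j\<close> is the probability of playing \<open>i\<close> when the opponent's
  previous action was \<open>j\<close>, so it is the columns of \<open>X\<close> that are probability vectors.\<close>

definition reactive_strategy :: "real^'n^'m \<Rightarrow> bool" where
  "reactive_strategy X \<longleftrightarrow> (\<forall>j. mixed_strategy (column j X))"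

definition stationary :: "real^'n^'m \<Rightarrow> real^'n \<Rightarrow> real^'m" where
  "stationary X y = (\<chi> i. \<Sum>j\<in>UNIV. X $ i $ j * y $ j)"

definition stationary_payoff :: "real^'n^'m \<Rightarrow> real^'n^'m \<Rightarrow> real^'n \<Rightarrow> real" where
  "stationary_payoff U X y = payoff U (stationary X y) y"

text \<open>Partial derivatives of \<open>stationary_payoff\<close>, with all coordinates treated as
  independent: one coordinate is replaced by a variable and the others are kept.\<close>

definition grad_X :: "real^'n^'m \<Rightarrow> real^'n^'m \<Rightarrow> real^'n \<Rightarrow> 'm \<Rightarrow> 'n \<Rightarrow> real" where
  "grad_X U X y i j =
     deriv (\<lambda>s. stationary_payoff U
       (\<chi> i' j'. if i' = i \<and> j' = j then s else X $ i' $ j') y) (X $ i $ j)"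

definition grad_Y :: "real^'n^'m \<Rightarrow> real^'n^'m \<Rightarrow> real^'n \<Rightarrow> 'n \<Rightarrow> real" where
  "grad_Y U X y j =
     deriv (\<lambda>s. stationary_payoff U X (\<chi> j'. if j' = j then s else y $ j')) (y $ j)"

lemma stationary_payoff_expand:
  "stationary_payoff U X y =
     (\<Sum>i\<in>UNIV. \<Sum>j\<in>UNIV. \<Sum>j'\<in>UNIV. U $ i $ j' * X $ i $ j * y $ j * y $ j')"
proof -
  have "(\<Sum>j'\<in>UNIV. U $ i $ j' * (\<Sum>j\<in>UNIV. X $ i $ j * y $ j) * y $ j') =
        (\<Sum>j\<in>UNIV. \<Sum>j'\<in>UNIV. U $ i $ j' * X $ i $ j * y $ j * y $ j')" for i
    by (subst sum.swap) (simp add: sum_distrib_left sum_distrib_right mult_ac)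
  then show ?thesis
    by (simp add: stationary_payoff_def payoff_def stationary_def)
qed

lemma grad_X_eq:
  "grad_X U X y i j = y $ j * (\<Sum>j'\<in>UNIV. U $ i $ j' * y $ j')"
proof -
  let ?f = "\<lambda>s. stationary_payoff U
       (\<chi> i' j'. if i' = i \<and> j' = j then s else X $ i' $ j') y"
  have "(?f has_real_derivative
     (\<Sum>k\<in>UNIV. \<Sum>l\<in>UNIV. \<Sum>l'\<in>UNIV.
        U $ k $ l' * (if k = i \<and> l = j then 1 else 0) * y $ l * y $ l')) (at (X $ i $ j))"
    unfolding stationary_payoff_expand
    by (intro DERIV_sum) (auto intro!: derivative_eq_intros)
  also have "(\<Sum>k\<in>UNIV. \<Sum>l\<in>UNIV. \<Sum>l'\<in>UNIV.
        U $ k $ l' * (if k = i \<and> l = j then 1 else 0) * y $ l * y $ l') =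
      (\<Sum>k\<in>UNIV. \<Sum>l\<in>UNIV. if l = j then if k = i then
         (\<Sum>l'\<in>UNIV. U $ k $ l' * y $ l * y $ l') else 0 else 0)"
    by (intro sum.cong refl) auto
  also have "\<dots> = y $ j * (\<Sum>j'\<in>UNIV. U $ i $ j' * y $ j')"
    by (simp add: sum_distrib_left mult_ac)
  finally show ?thesis
    unfolding grad_X_def by (rule DERIV_imp_deriv)
qed

lemma grad_Y_eq:
  "grad_Y U X y j = (\<Sum>i\<in>UNIV. U $ i $ j * stationary X y $ i) +
     (\<Sum>i\<in>UNIV. X $ i $ j * (\<Sum>j'\<in>UNIV. U $ i $ j' * y $ j'))"
proof -
  let ?f = "\<lambda>s. stationary_payoff U X (\<chi> j'. if j' = j then s else y $ j')"
  let ?d = "\<lambda>l. if l = j then 1 else (0::real)"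
  have "(?f has_real_derivative
     (\<Sum>k\<in>UNIV. \<Sum>l\<in>UNIV. \<Sum>l'\<in>UNIV.
        U $ k $ l' * X $ k $ l * (?d l * y $ l' + y $ l * ?d l'))) (at (y $ j))"
    unfolding stationary_payoff_expand
    by (intro DERIV_sum) (auto intro!: derivative_eq_intros)
  also have "(\<Sum>k\<in>UNIV. \<Sum>l\<in>UNIV. \<Sum>l'\<in>UNIV.
        U $ k $ l' * X $ k $ l * (?d l * y $ l' + y $ l * ?d l')) =
      (\<Sum>k\<in>UNIV. \<Sum>l\<in>UNIV. if l = j then
          (\<Sum>l'\<in>UNIV. U $ k $ l' * X $ k $ l * y $ l') else 0) +
      (\<Sum>k\<in>UNIV. \<Sum>l\<in>UNIV. \<Sum>l'\<in>UNIV. if l' = j then U $ k $ l' * X $ k $ l * y $ l else 0)"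
    unfolding sum.distrib[symmetric]
  proof (intro sum.cong refl, goal_cases)
    case (1 k l)
    have "(\<Sum>l'\<in>UNIV. U $ k $ l' * X $ k $ l * (?d l * y $ l' + y $ l * ?d l')) =
      (\<Sum>l'\<in>UNIV. (if l = j then U $ k $ l' * X $ k $ l * y $ l' else 0) +
         (if l' = j then U $ k $ l' * X $ k $ l * y $ l else 0))"
      by (intro sum.cong refl) (simp add: distrib_left mult_ac)
    then show ?case
      by (simp add: sum.distrib)
  qed
  also have "\<dots> = (\<Sum>i\<in>UNIV. U $ i $ j * stationary X y $ i) +
     (\<Sum>i\<in>UNIV. X $ i $ j * (\<Sum>j'\<in>UNIV. U $ i $ j' * y $ j'))"
    by (simp add: sum_distrib_left stationary_def mult_ac)
  finally show ?thesis
    unfolding grad_Y_def by (rule DERIV_imp_deriv)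
qed

text \<open>A solution is a pair of curves defined for all times \<open>t \<ge> 0\<close>; values at negative
  times are irrelevant, since derivatives are taken within \<open>{0..}\<close>.\<close>

definition replicator_solution ::
  "real^'n^'m \<Rightarrow> (real \<Rightarrow> real^'n^'m) \<Rightarrow> (real \<Rightarrow> real^'n) \<Rightarrow> bool" where
  "replicator_solution U X y \<longleftrightarrow> (\<forall>t\<ge>0.
     (\<forall>i j. ((\<lambda>s. X s $ i $ j) has_real_derivative
        X t $ i $ j * (grad_X U (X t) (y t) i j
          - (\<Sum>i'\<in>UNIV. X t $ i' $ j * grad_X U (X t) (y t) i' j))) (at t within {0..})) \<and>
     (\<forall>j. ((\<lambda>s. y s $ j) has_real_derivative
        - (y t $ j) * (grad_Y U (X t) (y t) j
          - (\<Sum>j'\<in>UNIV. y t $ j' * grad_Y U (X t) (y t) j'))) (at t within {0..})))"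

definition matching_pennies :: "real^2^2" where
  "matching_pennies = vector [vector [1, -1], vector [-1, 1]]"

end

theory Submission
  imports Defs
begin

text \<open>
  Write \<open>v = y\<^sub>1 - y\<^sub>2\<close>. Along a solution the log odds ratio
  \<open>d = ln (x\<^sub>1\<^sub>|\<^sub>1 x\<^sub>2\<^sub>|\<^sub>2 / (x\<^sub>2\<^sub>|\<^sub>1 x\<^sub>1\<^sub>|\<^sub>2))\<close> satisfies \<open>d' = 2 v\<^sup>2\<close>, and the sum \<open>W\<close> of the
  logarithms of all six coordinates satisfies \<open>W' = 2 (x\<^sub>1\<^sub>|\<^sub>1 - x\<^sub>1\<^sub>|\<^sub>2) v\<^sup>2\<close>, where
  \<open>x\<^sub>1\<^sub>|\<^sub>1 - x\<^sub>1\<^sub>|\<^sub>2\<close> has the sign of \<open>d\<close>. Once \<open>d\<close> is nonnegative it stays so and \<open>W\<close> increases;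
  this keeps \<open>X\<close> away from the boundary, so \<open>d\<close> is bounded in any case. Since \<open>v\<close> is
  Lipschitz, Barbalat's lemma gives \<open>v \<longlonglongrightarrow> 0\<close>.
\<close>

section \<open>Scalar equations, monotonicity and Barbalat's lemma\<close>

text \<open>Integrating factor: \<open>z s * exp (- K s)\<close> has derivative zero. The formula
  shows that a positive start stays positive and a zero start stays zero.\<close>

lemma linear_ode_solution:
  fixes z k :: "real \<Rightarrow> real"
  assumes z: "\<And>t. t \<ge> 0 \<Longrightarrow> (z has_real_derivative k t * z t) (at t within {0..})"
    and k: "continuous_on {0..} k" and t: "t \<ge> 0"
  shows "z t = z 0 * exp (integral {0..t} k)"
proof -
  define K where "K = (\<lambda>s. integral {0..s} k)"
  have K: "(K has_real_derivative k s) (at s within {0..t})" if "s \<in> {0..t}" for s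
    unfolding K_def using that
    by (intro integral_has_real_derivative continuous_on_subset[OF k]) auto
  have "((\<lambda>s. z s * exp (- K s)) has_real_derivative 0) (at s within {0..t})"
    if "s \<in> {0..t}" for s
  proof -
    have "(z has_real_derivative k s * z s) (at s within {0..t})"
      using z[of s] that by (auto intro: has_field_derivative_subset)
    then show ?thesis
      using K[OF that] by (auto intro!: derivative_eq_intros)
  qed
  then have "\<exists>c. \<forall>s\<in>{0..t}. z s * exp (- K s) = c"
    by (intro has_field_derivative_zero_constant) simp_all
  then obtain c where c: "\<And>s. s \<in> {0..t} \<Longrightarrow> z s * exp (- K s) = c"
    by blast
  have "z t * exp (- K t) = z 0 * exp (- K 0)"
    using c[of t] c[of 0] t by simp
  then show ?thesis
    by (simp add: K_def exp_minus field_simps)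
qed

lemma mvt_atLeast:
  fixes f f' :: "real \<Rightarrow> real"
  assumes f: "\<And>t. t \<ge> a \<Longrightarrow> (f has_real_derivative f' t) (at t within {a..})"
    and "a \<le> s" "s < t"
  obtains z where "s < z" "z < t" "f t - f s = f' z * (t - s)"
proof -
  have "(f has_derivative (*) (f' x)) (at x within {s..t})" if "s \<le> x" "x \<le> t" for x
    using f[of x] that \<open>a \<le> s\<close>
    by (auto intro: has_field_derivative_subset simp flip: has_field_derivative_def)
  from mvt_simple[OF \<open>s < t\<close> this] that show ?thesis
    by auto
qed

text \<open>The left end \<open>a\<close> is left free because \<open>d\<close> is monotone from
  time 0, but \<open>W\<close> only from a later time \<open>T\<close>.\<close>

lemma nondecreasing_atLeast:
  fixes f f' :: "real \<Rightarrow> real"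
  assumes f: "\<And>t. t \<ge> a \<Longrightarrow> (f has_real_derivative f' t) (at t within {a..})"
    and nonneg: "\<And>t. t \<ge> a \<Longrightarrow> f' t \<ge> 0"
    and "a \<le> s" "s \<le> t"
  shows "f s \<le> f t"
proof (cases "s = t")
  case False
  with \<open>s \<le> t\<close> have "s < t" by simp
  from mvt_atLeast[OF f \<open>a \<le> s\<close> this]
  obtain z where "s < z" "f t - f s = f' z * (t - s)" by metis
  with nonneg[of z] \<open>a \<le> s\<close> \<open>s \<le> t\<close> have "f t - f s \<ge> 0" by simp
  then show ?thesis by simp
qed simp

text \<open>Once \<open>f\<close> is close to its supremum it can rise only little over a window of
  length \<open>\<delta>\<close>. So \<open>f'\<close> is small somewhere in that window, and the
  Lipschitz bound carries this back to the window's left end.\<close>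

lemma barbalat:
  fixes f f' :: "real \<Rightarrow> real"
  assumes f: "\<And>t. t \<ge> 0 \<Longrightarrow> (f has_real_derivative f' t) (at t within {0..})"
    and nonneg: "\<And>t. t \<ge> 0 \<Longrightarrow> f' t \<ge> 0"
    and bound: "\<And>t. t \<ge> 0 \<Longrightarrow> f t \<le> B"
    and lip: "L-lipschitz_on {0..} f'"
  shows "(f' \<longlongrightarrow> 0) at_top"
proof (rule tendstoI)
  fix e :: real
  assume "e > 0"
  \<comment> \<open>Chosen so that \<open>f'\<close> varies by less than \<open>e / 2\<close> over a
    window; \<open>L + 1\<close> avoids division by zero.\<close>
  define \<delta> where "\<delta> = e / (2 * (L + 1))"
  have "L \<ge> 0" using lip by (rule lipschitz_on_nonneg)
  then have "\<delta> > 0" and L\<delta>: "L * \<delta> < e / 2"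
    using \<open>e > 0\<close> by (auto simp: \<delta>_def field_simps)
  define S where "S = Sup (f ` {0..})"
  have bdd: "bdd_above (f ` {0..})"
    using bound by (auto simp: bdd_above_def)
  have "S - \<delta> * (e / 2) < S"
    using \<open>\<delta> > 0\<close> \<open>e > 0\<close> by simp
  then obtain T where T: "T \<ge> 0" "S - \<delta> * (e / 2) < f T"
    unfolding S_def using less_cSup_iff[OF _ bdd] by auto
  have "dist (f' t) 0 < e" if "t \<ge> T" for t
  proof -
    have "t \<ge> 0" "t < t + \<delta>" using that T \<open>\<delta> > 0\<close> by auto
    from mvt_atLeast[OF f this] obtain z
      where z: "t < z" "z < t + \<delta>" "f (t + \<delta>) - f t = f' z * (t + \<delta> - t)" by metis
    have "f T \<le> f t"
      using nondecreasing_atLeast[OF f nonneg T(1) that] .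
    moreover have "f (t + \<delta>) \<le> S"
      unfolding S_def using bdd \<open>t \<ge> 0\<close> \<open>\<delta> > 0\<close> by (intro cSup_upper) auto
    ultimately have "\<delta> * f' z < \<delta> * (e / 2)"
      using z(3) T(2) by (simp add: mult.commute)
    then have "f' z < e / 2"
      using \<open>\<delta> > 0\<close> by simp
    moreover have "\<bar>f' t - f' z\<bar> \<le> L * \<bar>t - z\<bar>"
      using lipschitz_onD[OF lip, of t z] z \<open>t \<ge> 0\<close> by (simp add: dist_real_def)
    moreover have "L * \<bar>t - z\<bar> \<le> L * \<delta>"
      using z \<open>L \<ge> 0\<close> by (intro mult_left_mono) auto
    ultimately show ?thesis
      using L\<delta> nonneg[OF \<open>t \<ge> 0\<close>] by simp
  qed
  then show "\<forall>\<^sub>F t in at_top. dist (f' t) 0 < e"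
    by (rule eventually_at_top_linorderI)
qed

lemma linear_ode_pos:
  fixes z k :: "real \<Rightarrow> real"
  assumes "\<And>t. t \<ge> 0 \<Longrightarrow> (z has_real_derivative k t * z t) (at t within {0..})"
    and "continuous_on {0..} k" and "0 < z 0" and "t \<ge> 0"
  shows "0 < z t"
  using linear_ode_solution[of z k t] assms by simp

lemma linear_ode_zero:
  fixes z k :: "real \<Rightarrow> real"
  assumes "\<And>t. t \<ge> 0 \<Longrightarrow> (z has_real_derivative k t * z t) (at t within {0..})"
    and "continuous_on {0..} k" and "z 0 = 0" and "t \<ge> 0"
  shows "z t = 0"
  using linear_ode_solution[of z k t] assms by simp

section \<open>Invariance of the open simplices\<close>

lemma replicator_solution_derivs:
  assumes "replicator_solution U X y" "t \<ge> 0"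
  shows "((\<lambda>s. X s $ i $ j) has_real_derivative
      X t $ i $ j * (grad_X U (X t) (y t) i j
        - (\<Sum>i'\<in>UNIV. X t $ i' $ j * grad_X U (X t) (y t) i' j))) (at t within {0..})"
    and "((\<lambda>s. y s $ j) has_real_derivative
      - (y t $ j) * (grad_Y U (X t) (y t) j
        - (\<Sum>j'\<in>UNIV. y t $ j' * grad_Y U (X t) (y t) j'))) (at t within {0..})"
  using assms unfolding replicator_solution_def by blast+

text \<open>The partial derivatives are continuous in time through their closed polynomial forms.
  This makes the coefficients of the linear equations below continuous.\<close>

lemma replicator_solution_continuous:
  assumes "replicator_solution U X y"
  shows "continuous_on {0..} (\<lambda>t. X t $ i $ j)"
    and "continuous_on {0..} (\<lambda>t. y t $ j)"
    and "continuous_on {0..} (\<lambda>t. grad_X U (X t) (y t) i j)"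
    and "continuous_on {0..} (\<lambda>t. grad_Y U (X t) (y t) j)"
proof -
  show X: "continuous_on {0..} (\<lambda>t. X t $ i $ j)" for i j
    using replicator_solution_derivs(1)[OF assms]
    by (intro DERIV_continuous_on) auto
  show y: "continuous_on {0..} (\<lambda>t. y t $ j)" for j
    using replicator_solution_derivs(2)[OF assms]
    by (intro DERIV_continuous_on) auto
  show "continuous_on {0..} (\<lambda>t. grad_X U (X t) (y t) i j)"
    unfolding grad_X_eq by (intro continuous_intros y)
  show "continuous_on {0..} (\<lambda>t. grad_Y U (X t) (y t) j)"
    unfolding grad_Y_eq stationary_def by (simp, intro continuous_intros X y)
qed

text \<open>Along a fixed solution the coordinate solves the linear equation \<open>z' = k z\<close>
  with \<open>k\<close> a given continuous function of time.\<close>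

lemma replicator_solution_X_pos:
  assumes sol: "replicator_solution U X y" and "0 < X 0 $ i $ j" "t \<ge> 0"
  shows "0 < X t $ i $ j"
proof -
  define k where "k t = grad_X U (X t) (y t) i j
      - (\<Sum>i'\<in>UNIV. X t $ i' $ j * grad_X U (X t) (y t) i' j)" for t
  have "((\<lambda>t. X t $ i $ j) has_real_derivative k t * X t $ i $ j) (at t within {0..})"
    if "t \<ge> 0" for t
    unfolding k_def by (rule DERIV_cong[OF replicator_solution_derivs(1)[OF sol that] mult.commute])
  moreover have "continuous_on {0..} k"
    unfolding k_def by (intro continuous_intros replicator_solution_continuous[OF sol])
  ultimately show ?thesis
    using assms(2,3) by (rule linear_ode_pos)
qed

lemma replicator_solution_y_pos:
  assumes sol: "replicator_solution U X y" and "0 < y 0 $ j" "t \<ge> 0"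
  shows "0 < y t $ j"
proof -
  define k where "k t = - (grad_Y U (X t) (y t) j
      - (\<Sum>j'\<in>UNIV. y t $ j' * grad_Y U (X t) (y t) j'))" for t
  have "((\<lambda>t. y t $ j) has_real_derivative k t * y t $ j) (at t within {0..})"
    if "t \<ge> 0" for t
    unfolding k_def
    by (rule DERIV_cong[OF replicator_solution_derivs(2)[OF sol that]])
      (simp only: mult_ac mult_minus_left mult_minus_right)
  moreover have "continuous_on {0..} k"
    unfolding k_def by (intro continuous_intros replicator_solution_continuous[OF sol])
  ultimately show ?thesis
    using assms(2,3) by (rule linear_ode_pos)
qed

text \<open>The defect of the column sum from 1 solves \<open>z' = - g z\<close> and starts at
  zero.\<close>

lemma replicator_solution_X_sum:
  fixes U :: "real^'n^'m"
  assumes sol: "replicator_solution U X y" and init: "(\<Sum>i\<in>UNIV. X 0 $ i $ j) = 1" and "t \<ge> 0"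
  shows "(\<Sum>i\<in>UNIV. X t $ i $ j) = 1"
proof -
  define g where "g t = (\<Sum>i'\<in>UNIV. X t $ i' $ j * grad_X U (X t) (y t) i' j)" for t
  \<comment> \<open>The \<open>- 0\<close> is the derivative of the constant 1; it gives the left
    side the shape that \<open>DERIV_diff\<close> produces.\<close>
  have sum: "(\<Sum>i\<in>UNIV. X t $ i $ j * (grad_X U (X t) (y t) i j - g t)) - 0 =
      - g t * ((\<Sum>i\<in>UNIV. X t $ i $ j) - 1)" for t
    by (simp add: right_diff_distrib sum_subtractf g_def left_diff_distrib flip: sum_distrib_right)
  have "((\<lambda>t. (\<Sum>i\<in>UNIV. X t $ i $ j) - 1) has_real_derivative
      - g t * ((\<Sum>i\<in>UNIV. X t $ i $ j) - 1)) (at t within {0..})" if "t \<ge> 0" for t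
    unfolding sum[symmetric] unfolding g_def
    by (intro DERIV_diff DERIV_sum DERIV_const replicator_solution_derivs(1)[OF sol that])
  moreover have "continuous_on {0..} (\<lambda>t. - g t)"
    unfolding g_def by (intro continuous_intros replicator_solution_continuous[OF sol])
  moreover have "(\<Sum>i\<in>UNIV. X 0 $ i $ j) - 1 = 0"
    using init by simp
  ultimately have "(\<Sum>i\<in>UNIV. X t $ i $ j) - 1 = 0"
    using \<open>t \<ge> 0\<close> by (rule linear_ode_zero)
  then show ?thesis by simp
qed

lemma replicator_solution_y_sum:
  fixes U :: "real^'n^'m"
  assumes sol: "replicator_solution U X y" and init: "(\<Sum>j\<in>UNIV. y 0 $ j) = 1" and "t \<ge> 0"
  shows "(\<Sum>j\<in>UNIV. y t $ j) = 1"
proof -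
  define h where "h t = (\<Sum>j'\<in>UNIV. y t $ j' * grad_Y U (X t) (y t) j')" for t
  have sum: "(\<Sum>j\<in>UNIV. - (y t $ j) * (grad_Y U (X t) (y t) j - h t)) - 0 =
      h t * ((\<Sum>j\<in>UNIV. y t $ j) - 1)" for t
    by (simp add: right_diff_distrib sum_subtractf sum_negf h_def flip: sum_distrib_right)
  have "((\<lambda>t. (\<Sum>j\<in>UNIV. y t $ j) - 1) has_real_derivative
      h t * ((\<Sum>j\<in>UNIV. y t $ j) - 1)) (at t within {0..})" if "t \<ge> 0" for t
    unfolding sum[symmetric] unfolding h_def
    by (intro DERIV_diff DERIV_sum DERIV_const replicator_solution_derivs(2)[OF sol that])
  moreover have "continuous_on {0..} h"
    unfolding h_def by (intro continuous_intros replicator_solution_continuous[OF sol])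
  moreover have "(\<Sum>j\<in>UNIV. y 0 $ j) - 1 = 0"
    using init by simp
  ultimately have "(\<Sum>j\<in>UNIV. y t $ j) - 1 = 0"
    using \<open>t \<ge> 0\<close> by (rule linear_ode_zero)
  then show ?thesis by simp
qed

section \<open>Convergence of the reduced three-dimensional flow\<close>

text \<open>Here \<open>p = x\<^sub>1\<^sub>|\<^sub>1\<close>, \<open>q = x\<^sub>1\<^sub>|\<^sub>2\<close>, \<open>r = y\<^sub>1\<close>, the simplex constraints having been eliminated.\<close>

lemma matching_pennies_flow_converges:
  fixes p q r v :: "real \<Rightarrow> real"
  assumes v: "\<And>t. v t = 2 * r t - 1"
    and p: "\<And>t. t \<ge> 0 \<Longrightarrow> (p has_real_derivative
        2 * p t * (1 - p t) * r t * v t) (at t within {0..})"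
    and q: "\<And>t. t \<ge> 0 \<Longrightarrow> (q has_real_derivative
        2 * q t * (1 - q t) * (1 - r t) * v t) (at t within {0..})"
    and r: "\<And>t. t \<ge> 0 \<Longrightarrow> (r has_real_derivative
        - 2 * r t * (1 - r t) * (p t + q t - 1 + 2 * (p t - q t) * v t)) (at t within {0..})"
    and p01: "\<And>t. t \<ge> 0 \<Longrightarrow> 0 < p t \<and> p t < 1"
    and q01: "\<And>t. t \<ge> 0 \<Longrightarrow> 0 < q t \<and> q t < 1"
    and r01: "\<And>t. t \<ge> 0 \<Longrightarrow> 0 < r t \<and> r t < 1"
  shows "(r \<longlongrightarrow> 1/2) at_top"
proof -
  define d where "d t = ln (p t) - ln (1 - p t) - ln (q t) + ln (1 - q t)" for t
  define W where "W t = ln (p t) + ln (1 - p t) + ln (q t) + ln (1 - q t)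
      + ln (r t) + ln (1 - r t)" for t
  \<comment> \<open>For an equation of the form \<open>f' = f (1 - f) c\<close>, taking logarithms
    cancels the denominators and leaves polynomial derivatives.\<close>
  have ln_deriv: "((\<lambda>t. ln (f t)) has_real_derivative (1 - f t) * c) (at t within {0..})"
    "((\<lambda>t. ln (1 - f t)) has_real_derivative - (f t) * c) (at t within {0..})"
    if "(f has_real_derivative f t * (1 - f t) * c) (at t within {0..})" "0 < f t \<and> f t < 1"
    for f :: "real \<Rightarrow> real" and t c
    using that by (auto intro!: derivative_eq_intros simp: field_simps)
  have p': "(p has_real_derivative p t * (1 - p t) * (2 * r t * v t)) (at t within {0..})"
    and q': "(q has_real_derivative q t * (1 - q t) * (2 * (1 - r t) * v t)) (at t within {0..})"
    and r': "(r has_real_derivative r t * (1 - r t) *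
        (- 2 * (p t + q t - 1 + 2 * (p t - q t) * v t))) (at t within {0..})"
    if "t \<ge> 0" for t
    by (rule DERIV_cong[OF p[OF that]] DERIV_cong[OF q[OF that]] DERIV_cong[OF r[OF that]]; algebra)+
  note lns = ln_deriv[OF p' p01] ln_deriv[OF q' q01] ln_deriv[OF r' r01]
  have d': "(d has_real_derivative 2 * (v t)\<^sup>2) (at t within {0..})" if "t \<ge> 0" for t
  proof -
    have "(d has_real_derivative (1 - p t) * (2 * r t * v t) - - (p t) * (2 * r t * v t)
        - (1 - q t) * (2 * (1 - r t) * v t) + - (q t) * (2 * (1 - r t) * v t)) (at t within {0..})"
      unfolding d_def using that by (intro DERIV_add DERIV_diff lns) auto
    then show ?thesis
      by (rule DERIV_cong) (simp add: v power2_eq_square algebra_simps)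
  qed
  \<comment> \<open>As \<open>1 - 2 r = - v\<close>, the terms without the factor
    \<open>2 (p - q) v\<close> of the \<open>r\<close> equation add up to
    \<open>-2 (p - q) v\<^sup>2\<close>, while that factor contributes
    \<open>4 (p - q) v\<^sup>2\<close>.\<close>
  have W': "(W has_real_derivative 2 * (p t - q t) * (v t)\<^sup>2) (at t within {0..})" if "t \<ge> 0" for t
  proof -
    have "(W has_real_derivative (1 - p t) * (2 * r t * v t) + - (p t) * (2 * r t * v t)
        + (1 - q t) * (2 * (1 - r t) * v t) + - (q t) * (2 * (1 - r t) * v t)
        + (1 - r t) * (- 2 * (p t + q t - 1 + 2 * (p t - q t) * v t))
        + - (r t) * (- 2 * (p t + q t - 1 + 2 * (p t - q t) * v t))) (at t within {0..})"
      unfolding W_def using that by (intro DERIV_add DERIV_diff lns) auto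
    then show ?thesis
      by (rule DERIV_cong) (simp add: v power2_eq_square algebra_simps)
  qed
  have d_mono: "d s \<le> d t" if "0 \<le> s" "s \<le> t" for s t
    by (rule nondecreasing_atLeast[OF d' _ that]) auto
  have "\<exists>B. \<forall>t\<ge>0. d t \<le> B"
  proof (cases "\<exists>T\<ge>0. d T \<ge> 0")
    case True
    then obtain T where T: "T \<ge> 0" "d T \<ge> 0" by blast
    \<comment> \<open>\<open>d\<close> is the difference of the log odds of \<open>p\<close> and
      \<open>q\<close>, hence negative whenever \<open>p < q\<close>.\<close>
    have pq: "p t \<ge> q t" if "t \<ge> T" for t
    proof (rule ccontr)
      assume "\<not> p t \<ge> q t"
      then have "ln (p t) < ln (q t)" "ln (1 - q t) < ln (1 - p t)"
        using p01[of t] q01[of t] that T by auto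
      then have "d t < 0" by (simp add: d_def)
      with d_mono[of T t] that T show False by simp
    qed
    have W_mono: "W T \<le> W t" if "t \<ge> T" for t
    proof (rule nondecreasing_atLeast[where a = T and f = W
          and f' = "\<lambda>x. 2 * (p x - q x) * (v x)\<^sup>2"])
      show "(W has_real_derivative 2 * (p x - q x) * (v x)\<^sup>2) (at x within {T..})" if "x \<ge> T" for x
        using W'[of x] that T by (auto intro: has_field_derivative_subset)
    qed (use pq that in auto)
    \<comment> \<open>In \<open>d + W\<close> the terms \<open>ln (1 - p)\<close> and
      \<open>ln q\<close> cancel; only logarithms of numbers below 1 remain, so
      \<open>d < - W\<close>.\<close>
    have "d t \<le> - W T" if "t \<ge> T" for t
    proof -
      have "ln (p t) < 0" "ln (1 - q t) < 0" "ln (r t) < 0" "ln (1 - r t) < 0"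
        using p01[of t] q01[of t] r01[of t] that T by auto
      with W_mono[OF that] show ?thesis by (simp add: d_def W_def)
    qed
    moreover have "d t \<le> d T" if "0 \<le> t" "t \<le> T" for t
      using d_mono that by blast
    ultimately show ?thesis
      by (intro exI[of _ "max (d T) (- W T)"]) (meson le_max_iff_disj linear)
  next
    case False
    then show ?thesis by (intro exI[of _ 0]) force
  qed
  then obtain B where B: "\<And>t. t \<ge> 0 \<Longrightarrow> d t \<le> B" by blast
  \<comment> \<open>The derivative of \<open>2 v\<^sup>2\<close> is \<open>4 v v'\<close> with
    \<open>v' = 2 r'\<close>, whence the factor 16. The last factor is at most 1 + 2 = 3 in absolute
    value and the others at most 1, which gives the Lipschitz constant 48.\<close>
  define D where "D t = - (16 * ((v t * (r t * (1 - r t))) *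
      (p t + q t - 1 + 2 * (p t - q t) * v t)))" for t
  have v2': "((\<lambda>t. 2 * (v t)\<^sup>2) has_real_derivative D t) (at t within {0..})" if "t \<ge> 0" for t
    unfolding v D_def
    by (rule derivative_eq_intros r[OF that] refl)+ (simp add: v algebra_simps)
  have D_le: "\<bar>D t\<bar> \<le> 48" if "t \<ge> 0" for t
  proof -
    have "\<bar>v t\<bar> \<le> 1" "\<bar>r t\<bar> \<le> 1" "\<bar>1 - r t\<bar> \<le> 1" "\<bar>p t - q t\<bar> \<le> 1" and pq: "\<bar>p t + q t - 1\<bar> \<le> 1"
      using p01[OF that] q01[OF that] r01[OF that] by (auto simp: v)
    moreover from this have "\<bar>(p t - q t) * v t\<bar> \<le> 1"
      unfolding abs_mult by (intro mult_le_one) auto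
    with pq have "\<bar>p t + q t - 1 + 2 * (p t - q t) * v t\<bar> \<le> 3"
      unfolding mult.assoc by linarith
    ultimately have "(\<bar>v t\<bar> * (\<bar>r t\<bar> * \<bar>1 - r t\<bar>)) * \<bar>p t + q t - 1 + 2 * (p t - q t) * v t\<bar> \<le> 1 * 3"
      by (intro mult_mono mult_le_one) auto
    then show ?thesis
      unfolding D_def abs_mult abs_minus_cancel abs_numeral by linarith
  qed
  have "48-lipschitz_on {0..} (\<lambda>t. 2 * (v t)\<^sup>2)"
    using field_differentiable_bound[of "{0::real..}" "\<lambda>t. 2 * (v t)\<^sup>2" D 48] v2' D_le
    by (intro lipschitz_onI) (auto simp: dist_norm)
  then have "((\<lambda>t. 2 * (v t)\<^sup>2) \<longlongrightarrow> 0) at_top"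
    using d' B by (intro barbalat[of d _ B 48]) auto
  from tendsto_mult_left[OF this, of "1/2"] have "((\<lambda>t. (v t)\<^sup>2) \<longlongrightarrow> 0) at_top"
    by simp
  from tendsto_real_sqrt[OF this] have "(v \<longlongrightarrow> 0) at_top"
    by (simp add: tendsto_rabs_zero_iff)
  then have "((\<lambda>t. (v t + 1) / 2) \<longlongrightarrow> (0 + 1) / 2) at_top"
    by (intro tendsto_intros) auto
  then show ?thesis by (simp add: v)
qed

section \<open>Matching pennies: equilibrium and convergence\<close>

lemma matching_pennies_nth [simp]:
  "matching_pennies $ 1 $ 1 = 1" "matching_pennies $ 1 $ 2 = -1"
  "matching_pennies $ 2 $ 1 = -1" "matching_pennies $ 2 $ 2 = 1"
  by (simp_all add: matching_pennies_def)

lemma matching_pennies_payoff: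
  "payoff matching_pennies x y = (x $ 1 - x $ 2) * (y $ 1 - y $ 2)"
  by (simp add: payoff_def sum_2 algebra_simps)

lemma mixed_strategy_2:
  "mixed_strategy (x :: real^2) \<longleftrightarrow> 0 \<le> x $ 1 \<and> 0 \<le> x $ 2 \<and> x $ 1 + x $ 2 = 1"
  by (simp add: mixed_strategy_def forall_2 sum_2)

text \<open>Testing against pure strategies bounds the value below by
  \<open>\<bar>y $ 1 - y $ 2\<bar>\<close> and above by \<open>- \<bar>x $ 1 - x $ 2\<bar>\<close>,
  so both differences vanish. Conversely, a uniform strategy of either player makes the payoff zero
  whatever the other plays.\<close>

lemma matching_pennies_nash:
  "nash_equilibrium matching_pennies x y \<longleftrightarrow> x = vector [1/2, 1/2] \<and> y = vector [1/2, 1/2]"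
proof
  assume nash: "nash_equilibrium matching_pennies x y"
  let ?u = "payoff matching_pennies x y"
  have e: "mixed_strategy (vector [1, 0] :: real^2)" "mixed_strategy (vector [0, 1] :: real^2)"
    by (simp_all add: mixed_strategy_2)
  have "y $ 1 - y $ 2 \<le> ?u" "y $ 2 - y $ 1 \<le> ?u" "?u \<le> x $ 1 - x $ 2" "?u \<le> x $ 2 - x $ 1"
    using nash e unfolding nash_equilibrium_def
    by (force simp: matching_pennies_payoff)+
  then have "x $ 1 = x $ 2" "y $ 1 = y $ 2" by linarith+
  with nash show "x = vector [1/2, 1/2] \<and> y = vector [1/2, 1/2]"
    by (auto simp: nash_equilibrium_def mixed_strategy_2 vec_eq_iff forall_2)
qed (auto simp: nash_equilibrium_def mixed_strategy_2 matching_pennies_payoff)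

text \<open>Initial strategies are interior: a \<open>y\<close> started at a vertex of the simplex
  would stay there, and positive entries of \<open>X 0\<close> keep the log odds finite.\<close>

theorem corollary1:
  "(\<forall>x y. nash_equilibrium matching_pennies x y \<longleftrightarrow>
      x = vector [1/2, 1/2] \<and> y = vector [1/2, 1/2]) \<and>
   (\<forall>X y. replicator_solution matching_pennies X y \<and>
      reactive_strategy (X 0) \<and> (\<forall>i j. 0 < X 0 $ i $ j) \<and>
      mixed_strategy (y 0) \<and> (\<forall>j. 0 < y 0 $ j) \<longrightarrow>
      (y \<longlongrightarrow> vector [1/2, 1/2]) at_top)"
proof (intro conjI allI impI matching_pennies_nash, elim conjE)
  fix X :: "real \<Rightarrow> real^2^2" and y :: "real \<Rightarrow> real^2"
  assume sol: "replicator_solution matching_pennies X y"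
    and X0: "reactive_strategy (X 0)" "\<forall>i j. 0 < X 0 $ i $ j"
    and y0: "mixed_strategy (y 0)" "\<forall>j. 0 < y 0 $ j"
  have X_sum: "X t $ 2 $ j = 1 - X t $ 1 $ j" if "t \<ge> 0" for t j
    using replicator_solution_X_sum[OF sol, of j t] X0(1) that
    by (simp add: reactive_strategy_def mixed_strategy_def column_def sum_2)
  have y_sum: "y t $ 2 = 1 - y t $ 1" if "t \<ge> 0" for t
    using replicator_solution_y_sum[OF sol, of t] y0(1) that
    by (simp add: mixed_strategy_def sum_2)
  have X_pos: "0 < X t $ i $ j" if "t \<ge> 0" for t i j
    using replicator_solution_X_pos[OF sol] X0(2) that by blast
  have y_pos: "0 < y t $ j" if "t \<ge> 0" for t j
    using replicator_solution_y_pos[OF sol] y0(2) that by blast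
  have y1: "((\<lambda>t. y t $ 1) \<longlongrightarrow> 1/2) at_top"
  proof (rule matching_pennies_flow_converges[where p = "\<lambda>t. X t $ 1 $ 1" and q = "\<lambda>t. X t $ 1 $ 2"
        and v = "\<lambda>t. 2 * y t $ 1 - 1"])
    fix t :: real
    assume t: "t \<ge> 0"
    note X = X_sum[OF t] and y = y_sum[OF t]
    show "((\<lambda>t. X t $ 1 $ 1) has_real_derivative
        2 * X t $ 1 $ 1 * (1 - X t $ 1 $ 1) * y t $ 1 * (2 * y t $ 1 - 1)) (at t within {0..})"
      by (rule DERIV_cong[OF replicator_solution_derivs(1)[OF sol t]])
        (simp add: grad_X_eq sum_2 X y, simp add: algebra_simps)
    show "((\<lambda>t. X t $ 1 $ 2) has_real_derivative
        2 * X t $ 1 $ 2 * (1 - X t $ 1 $ 2) * (1 - y t $ 1) * (2 * y t $ 1 - 1)) (at t within {0..})"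
      by (rule DERIV_cong[OF replicator_solution_derivs(1)[OF sol t]])
        (simp add: grad_X_eq sum_2 X y, simp add: algebra_simps)
    show "((\<lambda>t. y t $ 1) has_real_derivative
        - 2 * y t $ 1 * (1 - y t $ 1) * (X t $ 1 $ 1 + X t $ 1 $ 2 - 1 +
          2 * (X t $ 1 $ 1 - X t $ 1 $ 2) * (2 * y t $ 1 - 1))) (at t within {0..})"
      by (rule DERIV_cong[OF replicator_solution_derivs(2)[OF sol t]])
        (simp add: grad_Y_eq stationary_def sum_2 X y, simp add: algebra_simps)
    show "0 < X t $ 1 $ 1 \<and> X t $ 1 $ 1 < 1" "0 < X t $ 1 $ 2 \<and> X t $ 1 $ 2 < 1"
      "0 < y t $ 1 \<and> y t $ 1 < 1"
      \<comment> \<open>The upper bounds by 1 are the positivity of the complementary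
        coordinates.\<close>
      using X_pos[OF t, of 1] X_pos[OF t, of 2] y_pos[OF t, of 1] y_pos[OF t, of 2]
      by (simp_all add: X y)
  qed simp
  have "((\<lambda>t. 1 - y t $ 1) \<longlongrightarrow> 1 - 1/2) at_top"
    by (intro tendsto_intros y1)
  \<comment> \<open>The coordinates sum to 1 only for nonnegative times, so the limit is transferred
    by eventual equality.\<close>
  moreover have "\<forall>\<^sub>F t in at_top. 1 - y t $ 1 = y t $ 2"
    using y_sum by (intro eventually_at_top_linorderI[of 0]) simp
  ultimately have "((\<lambda>t. y t $ 2) \<longlongrightarrow> 1/2) at_top"
    by (auto dest: Lim_transform_eventually)
  with y1 have "((\<lambda>t. y t $ i) \<longlongrightarrow> vector [1/2, 1/2] $ i) at_top" for i
    using exhaust_2[of i] by auto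
  then show "(y \<longlongrightarrow> vector [1/2, 1/2]) at_top"
    by (rule vec_tendstoI)
qed

end
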